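(* Let $q$ be a prime power and let $f:\mathbb{F}_q^n \rightarrow \mathbb{F}_q$ be an unknown multilinear polynomial of degree $d$ over $\mathbb{F}_q$. Then there is an exact quantum query algorithm which learns $f$ with certainty using $1 + \sum_{i=1}^d 2^{i-1} \binom{n}{i-1}$ queries to $f$; in particular this is $O(n^{d-1})$ for constant $d$.
   Context: $\mathbb{F}_q$ denotes the finite field with $q$ elements. A function $f:\mathbb{F}_q^n \rightarrow \mathbb{F}_q$ is a multilinear polynomial of degree $d$ if it can be written as $f(x) = \sum_{S \subseteq [n],|S|\le d} \alpha_S \prod_{i \in S} x_i$ for some coefficients $\alpha_S \in \mathbb{F}_q$, where $[n]=\{1,\dots,n\}$ and the empty product equals $1$. In the quantum query model, the algorithm accesses $f$ only via the unitary oracle $O_f \ket{x}\ket{y} = \ket{x}\ket{y + f(x)}$ for $x \in \mathbb{F}_q^n$, $y \in \mathbb{F}_q$ (interleaved with arbitrary oracle-independent unitaries and measurements); the number of queries is the number of applications of $O_f$. To learn $f$ means to output all coefficients $\alpha_S$; an exact algorithm does so with probability $1$ for every such $f$. *)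

theory Defs
  imports Complex_Main
begin

text \<open>Quantum query model over a finite field 'a (q = CARD('a), automatically a prime power).
  The n input variables are indexed by a finite type 'n with n = CARD('n).
  Computational basis states are triples (x, y, w): query input x in F_q^n,
  answer register y in F_q, workspace w in {0..<m}.\<close>

type_synonym ('n, 'a) qbasis = "('n \<Rightarrow> 'a) \<times> 'a \<times> nat"
type_synonym ('n, 'a) qstate = "('n, 'a) qbasis \<Rightarrow> complex"
type_synonym ('n, 'a) qmat = "('n, 'a) qbasis \<Rightarrow> ('n, 'a) qbasis \<Rightarrow> complex"

definition basis_set :: "nat \<Rightarrow> ('n, 'a) qbasis set" where
  "basis_set m = UNIV \<times> UNIV \<times> {..<m}"

definition qunitary :: "nat \<Rightarrow> ('n::finite, 'a::finite) qmat \<Rightarrow> bool" where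
  "qunitary m U \<longleftrightarrow> (\<forall>b\<in>basis_set m. \<forall>b'\<in>basis_set m.
      (\<Sum>c\<in>basis_set m. cnj (U c b) * U c b') = (if b = b' then 1 else 0))"

definition mat_app :: "nat \<Rightarrow> ('n::finite, 'a::finite) qmat \<Rightarrow> ('n, 'a) qstate \<Rightarrow> ('n, 'a) qstate" where
  "mat_app m U \<psi> = (\<lambda>b. if b \<in> basis_set m then (\<Sum>b'\<in>basis_set m. U b b' * \<psi> b') else 0)"

text \<open>The query operator O_f |x>|y>|w> = |x>|y + f x>|w>, acting on amplitudes.\<close>
definition query_op :: "(('n \<Rightarrow> 'a) \<Rightarrow> 'a::ab_group_add) \<Rightarrow> ('n, 'a) qstate \<Rightarrow> ('n, 'a) qstate" where
  "query_op f \<psi> = (\<lambda>(x, y, w). \<psi> (x, y - f x, w))"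

definition init_state :: "('n, 'a::zero) qstate" where
  "init_state = (\<lambda>b. if b = (\<lambda>_. 0, 0, 0) then 1 else 0)"

definition final_state :: "nat \<Rightarrow> (('n \<Rightarrow> 'a) \<Rightarrow> 'a) \<Rightarrow> ('n::finite, 'a::{finite,ab_group_add}) qmat
    \<Rightarrow> ('n, 'a) qmat list \<Rightarrow> ('n, 'a) qstate" where
  "final_state m f U0 Us = foldl (\<lambda>\<psi> U. mat_app m U (query_op f \<psi>)) (mat_app m U0 init_state) Us"

definition out_prob :: "nat \<Rightarrow> ('n, 'a) qstate \<Rightarrow> (('n, 'a) qbasis \<Rightarrow> 'o) \<Rightarrow> 'o \<Rightarrow> real" where
  "out_prob m \<psi> out v = (\<Sum>b\<in>basis_set m. if out b = v then (cmod (\<psi> b))\<^sup>2 else 0)"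

definition mlpoly :: "('n::finite set \<Rightarrow> 'a::comm_ring_1) \<Rightarrow> ('n \<Rightarrow> 'a) \<Rightarrow> 'a" where
  "mlpoly \<alpha> x = (\<Sum>S\<in>UNIV. \<alpha> S * (\<Prod>i\<in>S. x i))"

definition deg_le :: "nat \<Rightarrow> ('n set \<Rightarrow> 'a::zero) \<Rightarrow> bool" where
  "deg_le d \<alpha> \<longleftrightarrow> (\<forall>S. d < card S \<longrightarrow> \<alpha> S = 0)"

end

theory Submission
  imports Defs "HOL-Library.Cardinality" "HOL-Computational_Algebra.Primes"
    "HOL-Combinatorics.Transposition"
begin

text \<open>The |S|-fold finite difference of f in the directions of the variables in S costs
  $2^{|S|}$ queries to add to the answer register, and for a multilinear f it is the formal partial
  derivative, in which the constant term is the coefficient of S and the linear terms are the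
  coefficients of the sets \<open>insert j S\<close>. The sets S with \<open>|S| < d\<close> are treated in order of
  decreasing size, so all terms of higher degree are already known and can be subtracted; what
  remains is affine, and its linear part is read off exactly by one Fourier transform and its
  inverse (Bernstein--Vazirani), the constant term becoming a global phase. Throughout, the answer
  register returns to the value 1, the frequency of the Fourier state. The constant coefficient is
  obtained by one last query at the origin.\<close>

section \<open>Additive characters of finite fields\<close>

locale additive_character =
  fixes \<chi> :: "'a::{finite,field} \<Rightarrow> complex"
  assumes char_add: "\<chi> (x + y) = \<chi> x * \<chi> y"
    and cmod_char [simp]: "cmod (\<chi> x) = 1"
    and char_nontrivial: "\<exists>x. \<chi> x \<noteq> 1"

definition additive_subgroup :: "'a::ab_group_add set \<Rightarrow> bool" where
  "additive_subgroup H \<longleftrightarrow> 0 \<in> H \<and> (\<forall>x\<in>H. \<forall>y\<in>H. x - y \<in> H)"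

lemma additive_subgroupD:
  assumes "additive_subgroup H"
  shows "0 \<in> H" "x \<in> H \<Longrightarrow> y \<in> H \<Longrightarrow> x - y \<in> H" "x \<in> H \<Longrightarrow> - x \<in> H"
    "x \<in> H \<Longrightarrow> y \<in> H \<Longrightarrow> x + y \<in> H"
proof -
  show z: "0 \<in> H" and d: "x \<in> H \<Longrightarrow> y \<in> H \<Longrightarrow> x - y \<in> H" for x y
    using assms by (auto simp: additive_subgroup_def)
  show m: "x \<in> H \<Longrightarrow> - x \<in> H" for x
    using d[OF z, of x] by simp
  show "x \<in> H \<Longrightarrow> y \<in> H \<Longrightarrow> x + y \<in> H"
    using d[of x "- y"] m by simp
qed

lemma additive_subgroup_of_int_mult:
  fixes H :: "'a::comm_ring_1 set"
  assumes "additive_subgroup H" "x \<in> H"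
  shows "of_int k * x \<in> H"
proof (induction k rule: int_induct[where k = 0])
  case base
  then show ?case using additive_subgroupD(1)[OF assms(1)] by simp
next
  case (step1 i)
  then show ?case
    using additive_subgroupD(4)[OF assms(1) step1(2) assms(2)] by (simp add: algebra_simps)
next
  case (step2 i)
  then show ?case
    using additive_subgroupD(2)[OF assms(1) step2(2) assms(2)] by (simp add: algebra_simps)
qed

text \<open>A maximal subgroup avoiding 1 is a complement of the prime field, and projection onto the
  prime field along it gives a character.\<close>

lemma ex_complement_prime_field:
  "\<exists>H :: 'a::{finite,field} set. additive_subgroup H \<and> 1 \<notin> H \<and> (\<forall>x. \<exists>k. x - of_int k \<in> H)"
proof -
  let ?A = "{H :: 'a set. additive_subgroup H \<and> 1 \<notin> H}"
  have "{0} \<in> ?A" by (simp add: additive_subgroup_def)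
  then have "?A \<noteq> {}" by (metis empty_iff)
  from finite_has_maximal[OF finite this]
  obtain H where "H \<in> ?A" "\<forall>K\<in>?A. H \<subseteq> K \<longrightarrow> H = K" ..
  then have H: "additive_subgroup H" "1 \<notin> H"
    and max: "\<And>K. additive_subgroup K \<Longrightarrow> 1 \<notin> K \<Longrightarrow> H \<subseteq> K \<Longrightarrow> H = K"
    by auto
  note sg = additive_subgroupD[OF H(1)] and mult = additive_subgroup_of_int_mult[OF H(1)]
  have "\<exists>k. a - of_int k \<in> H" for a
  proof (cases "a \<in> H")
    case True
    then show ?thesis by (intro exI[of _ 0]) simp
  next
    case False
    \<comment> \<open>\<open>K\<close> is the subgroup generated by \<open>H\<close> and
      \<open>a\<close>. It is strictly larger than \<open>H\<close>, so by maximality it contains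
      1.\<close>
    define K where "K = {h + of_int k * a | h k. h \<in> H}"
    have "additive_subgroup K"
      unfolding additive_subgroup_def
    proof (intro conjI ballI)
      show "0 \<in> K" unfolding K_def using sg(1) by (auto intro!: exI[of _ 0])
      fix x y assume "x \<in> K" "y \<in> K"
      then obtain h k h' k' where "h \<in> H" "h' \<in> H" "x = h + of_int k * a" "y = h' + of_int k' * a"
        unfolding K_def by auto
      then show "x - y \<in> K"
        unfolding K_def using sg(2)
        by (auto intro!: exI[of _ "h - h'"] exI[of _ "k - k'"] simp: algebra_simps)
    qed
    moreover have "H \<subseteq> K"
    proof
      fix x assume "x \<in> H"
      then have "x + of_int 0 * a \<in> K" unfolding K_def by blast
      then show "x \<in> K" by simp
    qed
    moreover have "0 + of_int 1 * a \<in> K" unfolding K_def using sg(1) by blast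
    then have "a \<in> K" by simp
    ultimately have "1 \<in> K" using max False by blast
    then obtain h k where hk: "h \<in> H" "1 = h + of_int k * a" unfolding K_def by auto
    \<comment> \<open>Otherwise the multiple of \<open>a\<close> vanishes and \<open>1 = h\<close>
      lies in \<open>H\<close>. So \<open>k\<close> is invertible modulo the characteristic, and
      multiplying the equation for 1 by the inverse \<open>u\<close> shows that \<open>a\<close> is
      the integer \<open>u\<close> modulo \<open>H\<close>.\<close>
    have "\<not> int CHAR('a) dvd k"
    proof
      assume "int CHAR('a) dvd k"
      then have "of_int k = (0 :: 'a)" by (simp add: of_int_eq_0_iff_char_dvd)
      with hk H(2) show False by simp
    qed
    moreover have "prime (int CHAR('a))"
      using prime_CHAR_semidom[where 'a = 'a] finite_imp_CHAR_pos[where 'a = 'a] by simp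
    ultimately have "coprime k (int CHAR('a))"
      by (metis coprime_commute prime_imp_coprime)
    then obtain u v where "u * k + v * int CHAR('a) = 1"
      using bezout_int[of k "int CHAR('a)"] by auto
    then have "of_int (u * k + v * int CHAR('a)) = (1 :: 'a)" by simp
    then have uk: "of_int u * of_int k = (1 :: 'a)" by simp
    have "of_int u = of_int u * h + (of_int u * of_int k) * a"
      using arg_cong[OF hk(2), of "\<lambda>x. of_int u * x"] by (simp add: algebra_simps)
    then have "of_int u = of_int u * h + a" unfolding uk by simp
    then have "a - of_int u = - (of_int u * h)" by algebra
    then show ?thesis using sg(3) mult[OF hk(1)] by metis
  qed
  with H show ?thesis by blast
qed

lemma ex_additive_character: "\<exists>\<chi> :: 'a::{finite,field} \<Rightarrow> complex. additive_character \<chi>"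
proof -
  obtain H :: "'a set" where H: "additive_subgroup H" "1 \<notin> H" "\<And>x. \<exists>k. x - of_int k \<in> H"
    using ex_complement_prime_field by metis
  note sg = additive_subgroupD[OF H(1)] and mult = additive_subgroup_of_int_mult[OF H(1)]
  define p where "p = CHAR('a)"
  have p: "prime p"
    unfolding p_def using prime_CHAR_semidom[where 'a = 'a] finite_imp_CHAR_pos[where 'a = 'a] by simp
  then have p0: "p > 0" by (rule prime_gt_0_nat)
  \<comment> \<open>The integer representing an element modulo \<open>H\<close> is unique modulo
    \<open>p\<close>: an integer in \<open>H\<close> that is prime to \<open>p\<close> would, by
    Bezout, put 1 into \<open>H\<close>.\<close>
  have int_in_H: "int p dvd k" if "of_int k \<in> H" for k
  proof (rule ccontr)
    assume "\<not> int p dvd k"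
    then have "coprime k (int p)"
      using p by (metis coprime_commute prime_imp_coprime prime_nat_int_transfer)
    then obtain u v where "u * k + v * int p = 1"
      using bezout_int[of k "int p"] by auto
    then have "of_int (u * k + v * int p) = (1 :: 'a)" by simp
    then have "of_int u * of_int k = (1 :: 'a)" by (simp add: p_def)
    with mult[OF that, of u] H(2) show False by simp
  qed
  define e where "e k = cis (2 * pi * of_int k / of_nat p)" for k :: int
  have e_add: "e (k + l) = e k * e l" for k l
    by (simp add: e_def cis_mult algebra_simps add_divide_distrib)
  have e_period: "e k = 1" if "int p dvd k" for k
  proof -
    from that obtain l where "k = int p * l" by blast
    then have "of_int k / of_nat p = (of_int l :: real)" using p0 by simp
    then have "e k = cis (2 * pi * of_int l)"
      unfolding e_def times_divide_eq_right[symmetric] by (rule arg_cong)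
    also have "\<dots> = 1" by (rule cis_multiple_2pi) simp
    finally show ?thesis .
  qed
  have e_cong: "e k = e l" if "int p dvd k - l" for k l
    using e_add[of "k - l" l] e_period[OF that] by simp
  define \<chi> where "\<chi> x = e (SOME k. x - of_int k \<in> H)" for x :: 'a
  \<comment> \<open>Independence of the representative chosen by \<open>SOME\<close>; additivity
    follows from it.\<close>
  have \<chi>: "\<chi> x = e k" if "x - of_int k \<in> H" for x k
  proof -
    let ?l = "SOME k. x - of_int k \<in> H"
    have "x - of_int ?l \<in> H" using that by (rule someI)
    then have "of_int (?l - k) \<in> H" using sg(2)[OF that, of "x - of_int ?l"] by simp
    then show ?thesis unfolding \<chi>_def by (intro e_cong int_in_H)
  qed
  have "\<chi> (x + y) = \<chi> x * \<chi> y" for x y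
  proof -
    obtain k l where "x - of_int k \<in> H" "y - of_int l \<in> H" using H(3) by metis
    moreover from this have "x + y - of_int (k + l) \<in> H"
      using sg(4)[of "x - of_int k" "y - of_int l"] by (simp add: algebra_simps)
    ultimately show ?thesis using \<chi> e_add by metis
  qed
  moreover have "cmod (\<chi> x) = 1" for x by (simp add: \<chi>_def e_def)
  \<comment> \<open>1 is sent to the primitive root \<open>e 1\<close>, so triviality would make
    \<open>p\<close> divide 1.\<close>
  moreover have "\<chi> 1 \<noteq> 1"
  proof
    assume "\<chi> 1 = 1"
    moreover have "\<chi> 1 = e 1" using \<chi>[of 1 1] sg(1) by simp
    ultimately have "cos (2 * pi / p) = 1" by (simp add: e_def complex_eq_iff)
    then obtain n :: int where "2 * pi / p = n * 2 * pi" using cos_one_2pi_int by auto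
    then have "real_of_int (n * int p) = 1" using p0 by (simp add: field_simps)
    then have "n * int p = 1" by linarith
    then have "int p dvd 1" by (metis dvd_triv_right)
    with p show False by simp
  qed
  ultimately show ?thesis unfolding additive_character_def by blast
qed

context additive_character
begin

lemma char_0 [simp]: "\<chi> 0 = 1"
proof -
  have "\<chi> 0 * \<chi> 0 = \<chi> 0" using char_add[of 0 0] by simp
  moreover have "\<chi> 0 \<noteq> 0" using cmod_char[of 0] by force
  ultimately show ?thesis by simp
qed

lemma cnj_char: "cnj (\<chi> x) = \<chi> (- x)"
proof -
  have "\<chi> x * cnj (\<chi> x) = 1" using complex_norm_square[of "\<chi> x"] by simp
  moreover have "\<chi> x * \<chi> (- x) = 1" using char_add[of x "- x"] by simp
  ultimately show ?thesis
    by (metis mult_cancel_left zero_neq_one mult_zero_left)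
qed

end

section \<open>Quantum circuits over a finite basis type\<close>

type_synonym ('n, 'a, 'w) tbasis = "(('n \<Rightarrow> 'a) \<times> 'a) \<times> 'w"

text \<open>Orthonormality of the columns; for a square matrix this is unitarity, in the same form
  as \<open>qunitary\<close>.\<close>

definition orthonormal :: "('b::finite \<Rightarrow> 'b \<Rightarrow> complex) \<Rightarrow> bool" where
  "orthonormal U \<longleftrightarrow> (\<forall>b b'. (\<Sum>c\<in>UNIV. cnj (U c b) * U c b') = (if b = b' then 1 else 0))"

definition mat_vec :: "('b::finite \<Rightarrow> 'b \<Rightarrow> complex) \<Rightarrow> ('b \<Rightarrow> complex) \<Rightarrow> 'b \<Rightarrow> complex" where
  "mat_vec U \<psi> = (\<lambda>b. \<Sum>b'\<in>UNIV. U b b' * \<psi> b')"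

definition unitary_op :: "(('b::finite \<Rightarrow> complex) \<Rightarrow> ('b \<Rightarrow> complex)) \<Rightarrow> bool" where
  "unitary_op T \<longleftrightarrow> (\<exists>U. orthonormal U \<and> T = mat_vec U)"

lemma unitary_op_comp:
  assumes "unitary_op T" "unitary_op T'"
  shows "unitary_op (T \<circ> T')"
proof -
  obtain V U where V: "orthonormal V" "T = mat_vec V" and U: "orthonormal U" "T' = mat_vec U"
    using assms unfolding unitary_op_def by blast
  define M where "M = (\<lambda>b b'. \<Sum>d\<in>UNIV. V b d * U d b')"
  have "orthonormal M"
    unfolding orthonormal_def
  proof (intro allI)
    fix b b'
    have "(\<Sum>c\<in>UNIV. cnj (M c b) * M c b') =
        (\<Sum>c\<in>UNIV. \<Sum>d\<in>UNIV. \<Sum>e\<in>UNIV. cnj (U d b) * U e b' * (cnj (V c d) * V c e))"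
      unfolding M_def cnj_sum sum_product by (simp add: algebra_simps)
    also have "\<dots> = (\<Sum>d\<in>UNIV. \<Sum>c\<in>UNIV. \<Sum>e\<in>UNIV. cnj (U d b) * U e b' * (cnj (V c d) * V c e))"
      by (rule sum.swap)
    also have "\<dots> = (\<Sum>d\<in>UNIV. \<Sum>e\<in>UNIV. \<Sum>c\<in>UNIV. cnj (U d b) * U e b' * (cnj (V c d) * V c e))"
      by (intro sum.cong refl sum.swap)
    also have "\<dots> = (\<Sum>d\<in>UNIV. \<Sum>e\<in>UNIV. cnj (U d b) * U e b' * (if d = e then 1 else 0))"
      using V(1) unfolding orthonormal_def sum_distrib_left[symmetric] by simp
    also have "\<dots> = (\<Sum>d\<in>UNIV. cnj (U d b) * U d b')"
      by (simp add: if_distrib[of "\<lambda>x. _ * x"] cong: if_cong)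
    also have "\<dots> = (if b = b' then 1 else 0)"
      using U(1) by (simp add: orthonormal_def)
    finally show "(\<Sum>c\<in>UNIV. cnj (M c b) * M c b') = (if b = b' then 1 else 0)" .
  qed
  moreover have "T \<circ> T' = mat_vec M"
    unfolding V(2) U(2) M_def mat_vec_def comp_def sum_distrib_left sum_distrib_right
    by (intro ext, subst sum.swap) (simp add: mult.assoc)
  ultimately show ?thesis unfolding unitary_op_def by blast
qed

text \<open>For a bijection this is the permutation operator of the inverse of
  \<open>\<rho>\<close>: it sends \<open>ket c\<close> to \<open>ket b\<close> with
  \<open>\<rho> b = c\<close>. Hence adding a value to a register appears as subtraction under
  \<open>pull\<close>.\<close>

definition pull :: "('b \<Rightarrow> 'b) \<Rightarrow> ('b \<Rightarrow> complex) \<Rightarrow> 'b \<Rightarrow> complex" where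
  "pull \<rho> \<psi> = (\<lambda>b. \<psi> (\<rho> b))"

lemma unitary_op_pull:
  fixes \<rho> :: "'b::finite \<Rightarrow> 'b"
  assumes "bij \<rho>"
  shows "unitary_op (pull \<rho>)"
proof -
  define U where "U = (\<lambda>b b'. if b' = \<rho> b then 1 else 0 :: complex)"
  have "(\<Sum>c\<in>UNIV. cnj (U c b) * U c b') = (if b = b' then 1 else 0)" for b b'
  proof -
    have "(\<Sum>c\<in>UNIV. cnj (U c b) * U c b') =
        (\<Sum>c\<in>UNIV. (\<lambda>c. (if b = c then 1 else 0) * (if b' = c then 1 else 0)) (\<rho> c))"
      unfolding U_def by (intro sum.cong) auto
    also have "\<dots> = (\<Sum>c\<in>UNIV. (if b = c then 1 else 0) * (if b' = c then 1 else 0))"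
      by (rule sum.reindex_bij_betw) (use assms in simp)
    also have "\<dots> = (\<Sum>c\<in>UNIV. if b = c then (if b' = b then 1 else 0) else 0)"
      by (intro sum.cong) auto
    finally show ?thesis by auto
  qed
  then have "orthonormal U" by (simp add: orthonormal_def)
  moreover have "pull \<rho> = mat_vec U"
    by (intro ext) (simp add: pull_def mat_vec_def U_def if_distrib[of "\<lambda>x. x * _"] cong: if_cong)
  ultimately show ?thesis unfolding unitary_op_def by blast
qed

lemma unitary_op_pull_involution:
  fixes \<rho> :: "'b::finite \<Rightarrow> 'b"
  shows "(\<And>b. \<rho> (\<rho> b) = b) \<Longrightarrow> unitary_op (pull \<rho>)"
  by (intro unitary_op_pull o_bij[of \<rho>]) auto

definition ket :: "'b \<Rightarrow> 'b \<Rightarrow> complex" where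
  "ket b = (\<lambda>b'. if b' = b then 1 else 0)"

lemma pull_transpose_ket: "pull (transpose a b) (ket a) = ket b"
  by (auto simp: pull_def ket_def transpose_def fun_eq_iff)

lemma unitary_op_id: "unitary_op (\<lambda>\<psi>. \<psi>)"
  using unitary_op_pull_involution[of "\<lambda>b. b"] by (simp add: pull_def[abs_def])

text \<open>The unitaries are fixed before \<open>f\<close> is bound, so \<open>f\<close> is reached
  only through the counted queries. The alternation of queries and unitaries mirrors
  \<open>final_state\<close>.\<close>

inductive circuit :: "nat \<Rightarrow> ((('n::finite \<Rightarrow> 'a::{finite,ab_group_add}) \<Rightarrow> 'a)
    \<Rightarrow> (('n, 'a, 'w::finite) tbasis \<Rightarrow> complex) \<Rightarrow> ('n, 'a, 'w) tbasis \<Rightarrow> complex) \<Rightarrow> bool" where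
  circuit_unitary: "unitary_op T \<Longrightarrow> circuit 0 (\<lambda>f. T)"
| circuit_query: "circuit k F \<Longrightarrow> unitary_op T \<Longrightarrow>
    circuit (Suc k) (\<lambda>f. T \<circ> pull (\<lambda>((x, y), w). ((x, y - f x), w)) \<circ> F f)"

text \<open>The new unitary merges with the last one of the circuit, so it costs no query.\<close>

lemma circuit_then_unitary:
  assumes "circuit k F" "unitary_op T"
  shows "circuit k (\<lambda>f. T \<circ> F f)"
  using assms
proof cases
  case (circuit_unitary S)
  then show ?thesis
    using circuit.circuit_unitary[OF unitary_op_comp[OF assms(2)]] by simp
next
  case (circuit_query k' F' S)
  then show ?thesis
    using circuit.circuit_query[OF circuit_query(3) unitary_op_comp[OF assms(2) circuit_query(4)]]
    by (simp add: comp_assoc)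
qed

lemma circuit_comp:
  assumes "circuit k G" "circuit j F"
  shows "circuit (j + k) (\<lambda>f. G f \<circ> F f)"
  using assms(1)
proof induction
  case (circuit_unitary T)
  then show ?case using circuit_then_unitary[OF assms(2)] by (simp add: comp_def)
next
  case (circuit_query k G T)
  then show ?case
    using circuit.circuit_query[of "j + k" "\<lambda>f. G f \<circ> F f" T] by (simp add: comp_def)
qed

lemma unitary_then_circuit:
  assumes "circuit k F" "unitary_op T"
  shows "circuit k (\<lambda>f. F f \<circ> T)"
  using circuit_comp[OF assms(1) circuit_unitary[OF assms(2)]] by simp

section \<open>Adding functions of the input into the answer register\<close>

definition adds :: "nat \<Rightarrow> ((('n::finite \<Rightarrow> 'a::{finite,ab_group_add}) \<Rightarrow> 'a) \<Rightarrow> ('n \<Rightarrow> 'a) \<Rightarrow> 'a)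
    \<Rightarrow> 'w::finite itself \<Rightarrow> bool" where
  "adds k G _ \<longleftrightarrow> circuit k
     (\<lambda>f. pull (\<lambda>((x, y), w). ((x, y - G f x), w)) :: (('n, 'a, 'w) tbasis \<Rightarrow> complex) \<Rightarrow> _)"

lemma adds_oracle: "adds 1 (\<lambda>f. f) TYPE('w::finite)"
  using circuit_query[OF circuit_unitary[OF unitary_op_id] unitary_op_id]
  unfolding adds_def by (simp add: comp_def)

text \<open>Conjugation by a translation of the input adds \<open>G\<close> at the shifted point;
  conjugation by negation of the answer register turns addition of \<open>G\<close> into
  subtraction. Each half uses the circuit once.\<close>

lemma adds_diff_shift:
  fixes G :: "(('n::finite \<Rightarrow> 'a::{finite,ab_group_add}) \<Rightarrow> 'a) \<Rightarrow> ('n \<Rightarrow> 'a) \<Rightarrow> 'a"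
  assumes "adds k G TYPE('w::finite)"
  shows "adds (2 * k) (\<lambda>f x. G f (\<lambda>i. x i + a i) - G f x) TYPE('w)"
proof -
  let ?S = "\<lambda>((x, y), w). ((\<lambda>i. x i + a i, y), w) :: ('n, 'a, 'w) tbasis"
  let ?S' = "\<lambda>((x, y), w). ((\<lambda>i. x i - a i, y), w) :: ('n, 'a, 'w) tbasis"
  let ?N = "\<lambda>((x, y), w). ((x, - y), w) :: ('n, 'a, 'w) tbasis"
  have S: "unitary_op (pull ?S)" "unitary_op (pull ?S')"
    by (rule unitary_op_pull, rule o_bij[where g = ?S'], auto)
      (rule unitary_op_pull, rule o_bij[where g = ?S], auto)
  have N: "unitary_op (pull ?N)"
    by (rule unitary_op_pull_involution) auto
  note G = assms[unfolded adds_def]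
  let ?P = "\<lambda>f. pull (\<lambda>((x, y), w). ((x, y - G f x), w) :: ('n, 'a, 'w) tbasis)"
  have "circuit (k + k)
      (\<lambda>f. (pull ?S \<circ> (?P f \<circ> pull ?S')) \<circ> (pull ?N \<circ> (?P f \<circ> pull ?N)))"
    by (intro circuit_comp circuit_then_unitary unitary_then_circuit G S N)
  moreover have "(\<lambda>f. (pull ?S \<circ> (?P f \<circ> pull ?S')) \<circ> (pull ?N \<circ> (?P f \<circ> pull ?N))) =
      (\<lambda>f. pull (\<lambda>((x, y), w). ((x, y - (G f (\<lambda>i. x i + a i) - G f x)), w)))"
    by (auto simp: fun_eq_iff pull_def algebra_simps)
  ultimately show ?thesis by (simp add: adds_def mult_2)
qed

text \<open>Since f has degree at most one in each variable, its finite difference in the direction of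
  one variable is the partial derivative. Iterating over the variables in S doubles the number of
  queries each time.\<close>

lemma adds_derivative:
  fixes S :: "'n::finite set"
  shows "\<exists>G :: (('n \<Rightarrow> 'a::{finite,comm_ring_1}) \<Rightarrow> 'a) \<Rightarrow> ('n \<Rightarrow> 'a) \<Rightarrow> 'a.
    adds (2 ^ card S) G TYPE('w::finite) \<and>
    (\<forall>\<alpha> x. G (mlpoly \<alpha>) x = (\<Sum>R\<in>{R. S \<subseteq> R}. \<alpha> R * (\<Prod>i\<in>R - S. x i)))"
  using finite[of S]
proof induction
  case empty
  then show ?case
    by (intro exI[of _ "\<lambda>f. f"]) (use adds_oracle in \<open>auto simp: mlpoly_def\<close>)
next
  case (insert j S)
  then obtain G :: "(('n \<Rightarrow> 'a) \<Rightarrow> 'a) \<Rightarrow> ('n \<Rightarrow> 'a) \<Rightarrow> 'a" where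
    G: "adds (2 ^ card S) G TYPE('w)"
    "\<And>\<alpha> x. G (mlpoly \<alpha>) x = (\<Sum>R\<in>{R. S \<subseteq> R}. \<alpha> R * (\<Prod>i\<in>R - S. x i))"
    by blast
  define e where "e = (\<lambda>i. if i = j then 1 else 0 :: 'a)"
  define G' where "G' = (\<lambda>f x. G f (\<lambda>i. x i + e i) - G f x)"
  have "G' (mlpoly \<alpha>) x = (\<Sum>R\<in>{R. insert j S \<subseteq> R}. \<alpha> R * (\<Prod>i\<in>R - insert j S. x i))" for \<alpha> x
  proof -
    \<comment> \<open>Shifting along the unit vector \<open>e\<close> leaves monomials without
      \<open>j\<close> unchanged, and in the others the difference strips the factor
      \<open>x j\<close>.\<close>
    have "(\<Prod>i\<in>R - S. x i + e i) - (\<Prod>i\<in>R - S. x i) =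
        (if j \<in> R then \<Prod>i\<in>R - insert j S. x i else 0)" if "S \<subseteq> R" for R
    proof (cases "j \<in> R")
      case True
      then have "R - S = insert j (R - insert j S)" using insert.hyps by auto
      moreover have "(\<Prod>i\<in>R - insert j S. x i + e i) = (\<Prod>i\<in>R - insert j S. x i)"
        by (intro prod.cong) (auto simp: e_def)
      ultimately show ?thesis using True by (simp add: e_def algebra_simps)
    next
      case False
      then have "(\<Prod>i\<in>R - S. x i + e i) = (\<Prod>i\<in>R - S. x i)"
        by (intro prod.cong) (auto simp: e_def)
      then show ?thesis using False by simp
    qed
    then have "G' (mlpoly \<alpha>) x =
        (\<Sum>R\<in>{R. S \<subseteq> R}. \<alpha> R * (if j \<in> R then \<Prod>i\<in>R - insert j S. x i else 0))"
      unfolding G'_def G(2) sum_subtractf[symmetric]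
      by (intro sum.cong) (simp_all add: right_diff_distrib[symmetric])
    also have "\<dots> = (\<Sum>R\<in>{R. insert j S \<subseteq> R}. \<alpha> R * (\<Prod>i\<in>R - insert j S. x i))"
      by (rule sum.mono_neutral_cong_right) auto
    finally show ?thesis .
  qed
  moreover have "adds (2 ^ card (insert j S)) G' TYPE('w)"
    using adds_diff_shift[OF G(1), of e] insert.hyps by (simp add: G'_def)
  ultimately show ?case by blast
qed

section \<open>The Fourier transform on input and answer register\<close>

text \<open>The answer register serves as one more coordinate, so that a single transform treats
  both registers.\<close>

definition pairing :: "('n::finite \<Rightarrow> 'a::comm_ring_1) \<times> 'a \<Rightarrow> ('n \<Rightarrow> 'a) \<times> 'a \<Rightarrow> 'a" where
  "pairing g h = snd g * snd h + (\<Sum>i\<in>UNIV. fst g i * fst h i)"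

lemma pairing_commute: "pairing g h = pairing h g"
  by (simp add: pairing_def mult.commute)

text \<open>Nondegeneracy, in the form that the difference attains any prescribed \<open>t\<close>;
  it is applied to a \<open>t\<close> at which the character is nontrivial.\<close>

lemma pairing_separates:
  fixes h h' :: "('n::finite \<Rightarrow> 'a::field) \<times> 'a"
  assumes "h \<noteq> h'"
  shows "\<exists>g. pairing g h - pairing g h' = t"
proof (cases "snd h = snd h'")
  case False
  then have "pairing (\<lambda>_. 0, t / (snd h - snd h')) h - pairing (\<lambda>_. 0, t / (snd h - snd h')) h' = t"
    unfolding pairing_def by (simp add: diff_divide_distrib[symmetric] right_diff_distrib[symmetric])
  then show ?thesis by blast
next
  case True
  with assms obtain i where i: "fst h i \<noteq> fst h' i" by (metis ext prod_eq_iff)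
  define g where "g = (\<lambda>j. if j = i then t / (fst h i - fst h' i) else 0, 0 :: 'a)"
  have "pairing g k = t / (fst h i - fst h' i) * fst k i" for k
    unfolding pairing_def g_def by (simp add: if_distrib[of "\<lambda>x. x * _"] cong: if_cong)
  then have "pairing g h - pairing g h' = t"
    using i by (simp add: diff_divide_distrib[symmetric] right_diff_distrib[symmetric])
  then show ?thesis by blast
qed

context additive_character
begin

text \<open>Orthogonality of characters: for distinct \<open>h\<close> and \<open>h'\<close>,
  translating the summation variable by \<open>g0\<close> multiplies the sum by a factor other than
  1, so the sum vanishes.\<close>

lemma sum_char_pairing:
  fixes h h' :: "('n::finite \<Rightarrow> 'a) \<times> 'a"
  assumes "\<sigma> \<noteq> 0"
  shows "(\<Sum>g\<in>UNIV. \<chi> (\<sigma> * (pairing g h - pairing g h'))) =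
    (if h = h' then of_nat CARD(('n \<Rightarrow> 'a) \<times> 'a) else 0)"
proof (cases "h = h'")
  case True
  then show ?thesis by simp
next
  case False
  obtain t where t: "\<chi> t \<noteq> 1" using char_nontrivial by blast
  obtain g0 where g0: "pairing g0 h - pairing g0 h' = t / \<sigma>"
    using pairing_separates[OF False] by blast
  define s where "s = (\<lambda>g :: ('n \<Rightarrow> 'a) \<times> 'a. (\<lambda>i. fst g i + fst g0 i, snd g + snd g0))"
  have s: "bij s"
    by (rule o_bij[where g = "\<lambda>g. (\<lambda>i. fst g i - fst g0 i, snd g - snd g0)"])
      (auto simp: s_def)
  have pairing_s: "pairing (s g) k = pairing g k + pairing g0 k" for g k
    by (simp add: pairing_def s_def algebra_simps sum.distrib)
  have shift: "\<sigma> * (pairing (s g) h - pairing (s g) h') = \<sigma> * (pairing g h - pairing g h') + t" for g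
  proof -
    have "pairing (s g) h - pairing (s g) h' = (pairing g h - pairing g h') + t / \<sigma>"
      unfolding pairing_s g0[symmetric] by simp
    then show ?thesis using assms by (simp add: distrib_left)
  qed
  have "(\<Sum>g\<in>UNIV. \<chi> (\<sigma> * (pairing g h - pairing g h'))) =
      (\<Sum>g\<in>UNIV. \<chi> (\<sigma> * (pairing (s g) h - pairing (s g) h')))"
    by (rule sum.reindex_bij_betw[OF s, symmetric])
  also have "\<dots> = (\<Sum>g\<in>UNIV. \<chi> (\<sigma> * (pairing g h - pairing g h'))) * \<chi> t"
    by (simp only: shift char_add sum_distrib_right)
  finally show ?thesis using t False unfolding mult_cancel_left1 by simp
qed

definition fourier :: "'a \<Rightarrow> (('n::finite, 'a, 'w::finite) tbasis \<Rightarrow> complex)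
    \<Rightarrow> ('n, 'a, 'w) tbasis \<Rightarrow> complex" where
  "fourier \<sigma> \<psi> = (\<lambda>(g, w). (\<Sum>h\<in>UNIV. \<chi> (\<sigma> * pairing g h) * \<psi> (h, w)) /
     of_real (sqrt (of_nat CARD(('n \<Rightarrow> 'a) \<times> 'a))))"

lemma unitary_op_fourier:
  assumes "\<sigma> \<noteq> 0"
  shows "unitary_op (fourier \<sigma> :: (('n::finite, 'a, 'w::finite) tbasis \<Rightarrow> complex) \<Rightarrow> _)"
proof -
  define N where "N = CARD(('n \<Rightarrow> 'a) \<times> 'a)"
  have N: "N > 0" unfolding N_def by (rule zero_less_card_finite)
  define r where "r = complex_of_real (sqrt N)"
  have r: "r * r = of_nat N" "cnj r = r"
    unfolding r_def by (simp_all flip: of_real_mult)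
  define U :: "('n, 'a, 'w) tbasis \<Rightarrow> ('n, 'a, 'w) tbasis \<Rightarrow> complex"
    where "U = (\<lambda>(g, w) (h, v). if w = v then \<chi> (\<sigma> * pairing g h) / r else 0)"
  have "(\<Sum>c\<in>UNIV. cnj (U c (h, v)) * U c (h', v')) = (if (h, v) = (h', v') then 1 else 0)" for h h' v v'
  proof -
    have "(\<Sum>c\<in>UNIV. cnj (U c (h, v)) * U c (h', v')) =
        (\<Sum>g\<in>UNIV. \<Sum>w\<in>UNIV. cnj (U (g, w) (h, v)) * U (g, w) (h', v'))"
      unfolding UNIV_Times_UNIV[symmetric] by (simp add: sum.cartesian_product case_prod_beta)
    also have "\<dots> = (\<Sum>g\<in>UNIV. \<Sum>w\<in>UNIV. if w = v then
        (if v = v' then \<chi> (\<sigma> * (pairing g h' - pairing g h)) / of_nat N else 0) else 0)"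
    proof (intro sum.cong refl)
      fix g w
      have "\<sigma> * (pairing g h' - pairing g h) = - (\<sigma> * pairing g h) + \<sigma> * pairing g h'"
        by (simp add: right_diff_distrib)
      then have "\<chi> (\<sigma> * (pairing g h' - pairing g h)) =
          cnj (\<chi> (\<sigma> * pairing g h)) * \<chi> (\<sigma> * pairing g h')"
        by (simp only: char_add cnj_char)
      then show "cnj (U (g, w) (h, v)) * U (g, w) (h', v') = (if w = v then
          (if v = v' then \<chi> (\<sigma> * (pairing g h' - pairing g h)) / of_nat N else 0) else 0)"
        by (simp add: U_def r(2) r(1)[symmetric])
    qed
    also have "\<dots> = (if v = v' then (\<Sum>g\<in>UNIV. \<chi> (\<sigma> * (pairing g h' - pairing g h))) / of_nat N else 0)"
      by (simp add: sum_divide_distrib)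
    also have "\<dots> = (if (h, v) = (h', v') then 1 else 0)"
      unfolding sum_char_pairing[OF assms] N_def[symmetric] using N by auto
    finally show ?thesis .
  qed
  then have "orthonormal U" unfolding orthonormal_def by (auto simp: split_paired_all)
  moreover have "fourier \<sigma> = mat_vec U"
  proof (intro ext)
    fix \<psi> :: "('n, 'a, 'w) tbasis \<Rightarrow> complex" and b :: "('n, 'a, 'w) tbasis"
    obtain g w where b: "b = (g, w)" by fastforce
    have "mat_vec U \<psi> b = (\<Sum>h\<in>UNIV. \<Sum>v\<in>UNIV. U b (h, v) * \<psi> (h, v))"
      unfolding mat_vec_def UNIV_Times_UNIV[symmetric]
      by (simp add: sum.cartesian_product case_prod_beta)
    also have "\<dots> = (\<Sum>h\<in>UNIV. \<Sum>v\<in>UNIV. if v = w then \<chi> (\<sigma> * pairing g h) / r * \<psi> (h, w) else 0)"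
      by (intro sum.cong) (auto simp: U_def b)
    also have "\<dots> = fourier \<sigma> \<psi> b"
      by (simp add: fourier_def b r_def N_def sum_divide_distrib)
    finally show "fourier \<sigma> \<psi> b = mat_vec U \<psi> b" by simp
  qed
  ultimately show ?thesis unfolding unitary_op_def by blast
qed

text \<open>Symmetry of the pairing brings the inner sum over \<open>h\<close> into the form of the
  orthogonality relation, which collapses it to \<open>k = g\<close>.\<close>

lemma fourier_inverse:
  fixes \<psi> :: "('n::finite, 'a, 'w::finite) tbasis \<Rightarrow> complex"
  assumes "\<sigma> \<noteq> 0"
  shows "fourier (- \<sigma>) (fourier \<sigma> \<psi>) = \<psi>"
proof (intro ext)
  fix b :: "('n, 'a, 'w) tbasis"
  obtain g w where b: "b = (g, w)" by fastforce
  define N where "N = CARD(('n \<Rightarrow> 'a) \<times> 'a)"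
  have N: "N > 0" unfolding N_def by (rule zero_less_card_finite)
  define r where "r = complex_of_real (sqrt N)"
  have r: "r * r = of_nat N"
    unfolding r_def by (simp flip: of_real_mult)
  have "fourier (- \<sigma>) (fourier \<sigma> \<psi>) b =
      (\<Sum>h\<in>UNIV. \<chi> (- \<sigma> * pairing g h) * ((\<Sum>k\<in>UNIV. \<chi> (\<sigma> * pairing h k) * \<psi> (k, w)) / r)) / r"
    unfolding fourier_def b r_def N_def by simp
  also have "\<dots> = (\<Sum>h\<in>UNIV. \<Sum>k\<in>UNIV. \<chi> (- \<sigma> * pairing g h) * (\<chi> (\<sigma> * pairing h k) * \<psi> (k, w))) / (r * r)"
    by (simp add: sum_distrib_left sum_divide_distrib)
  also have "(\<Sum>h\<in>UNIV. \<Sum>k\<in>UNIV. \<chi> (- \<sigma> * pairing g h) * (\<chi> (\<sigma> * pairing h k) * \<psi> (k, w))) =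
      (\<Sum>h\<in>UNIV. \<Sum>k\<in>UNIV. \<psi> (k, w) * \<chi> (\<sigma> * (pairing h k - pairing h g)))"
  proof (intro sum.cong refl)
    fix h k
    have "\<sigma> * (pairing h k - pairing h g) = - \<sigma> * pairing g h + \<sigma> * pairing h k"
      by (simp add: pairing_commute[of h g] algebra_simps)
    then show "\<chi> (- \<sigma> * pairing g h) * (\<chi> (\<sigma> * pairing h k) * \<psi> (k, w)) =
        \<psi> (k, w) * \<chi> (\<sigma> * (pairing h k - pairing h g))"
      by (simp only: char_add) simp
  qed
  also have "\<dots> = (\<Sum>k\<in>UNIV. \<psi> (k, w) * (\<Sum>h\<in>UNIV. \<chi> (\<sigma> * (pairing h k - pairing h g))))"
    unfolding sum_distrib_left by (rule sum.swap)
  also have "\<dots> = (\<Sum>k\<in>UNIV. if k = g then \<psi> (g, w) * of_nat N else 0)"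
    unfolding sum_char_pairing[OF assms] N_def by (intro sum.cong) auto
  also have "\<dots> / (r * r) = \<psi> b"
    using N by (simp add: r b)
  finally show "fourier (- \<sigma>) (fourier \<sigma> \<psi>) b = \<psi> b" .
qed

lemma fourier_ket:
  "fourier \<sigma> (\<lambda>b. c * ket (h, w) b) (g, v :: 'w::finite) =
     (if v = w then c * \<chi> (\<sigma> * pairing g (h :: ('n::finite \<Rightarrow> 'a) \<times> 'a)) /
        of_real (sqrt (of_nat CARD(('n \<Rightarrow> 'a) \<times> 'a))) else 0)"
  by (simp add: fourier_def ket_def if_distrib[of "\<lambda>x. _ * x"] cong: if_cong)

text \<open>The Bernstein--Vazirani argument: an affine shift of the answer register acts on a Fourier
  state as the phase that moves the linear coefficients into the input register.\<close>

lemma bernstein_vazirani: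
  fixes w :: "'w::finite" and l :: "'n::finite \<Rightarrow> 'a"
  assumes "\<And>x. L w x = a + (\<Sum>i\<in>UNIV. l i * x i)"
  shows "fourier (- 1) (pull (\<lambda>((x, y), w). ((x, y - L w x), w))
      (fourier 1 (\<lambda>b. c * ket ((\<lambda>_. 0, 1), w) b))) =
    (\<lambda>b. c * \<chi> (- a) * ket ((\<lambda>i. - l i, 1), w) b)"
proof -
  have "pull (\<lambda>((x, y), w). ((x, y - L w x), w)) (fourier 1 (\<lambda>b. c * ket ((\<lambda>_. 0, 1), w) b)) =
      fourier 1 (\<lambda>b. c * \<chi> (- a) * ket ((\<lambda>i. - l i, 1), w) b)"
  proof (intro ext)
    fix b :: "('n, 'a, 'w) tbasis"
    obtain x y v where b: "b = ((x, y), v)" by (metis surj_pair)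
    \<comment> \<open>At answer frequency 1 the shift by \<open>L w x\<close> enters the exponent
      linearly: its constant part is a phase, its linear part changes the input frequency from 0 to
      \<open>- l\<close>.\<close>
    have "pairing (x, y - L w x) (\<lambda>_. 0, 1) = - a + pairing (x, y) (\<lambda>i. - l i, 1)"
      unfolding assms by (simp add: pairing_def sum_negf mult.commute)
    then have "\<chi> (pairing (x, y - L w x) (\<lambda>_. 0, 1)) =
        \<chi> (- a) * \<chi> (pairing (x, y) (\<lambda>i. - l i, 1))"
      by (simp only: char_add)
    then show "pull (\<lambda>((x, y), w). ((x, y - L w x), w)) (fourier 1 (\<lambda>b. c * ket ((\<lambda>_. 0, 1), w) b)) b =
      fourier 1 (\<lambda>b. c * \<chi> (- a) * ket ((\<lambda>i. - l i, 1), w) b) b"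
      by (simp add: b pull_def fourier_ket)
  qed
  then show ?thesis using fourier_inverse[of 1] by simp
qed

end

section \<open>Learning the coefficients level by level\<close>

text \<open>The workspace has one register in \<open>'n \<Rightarrow> 'a\<close> for each set S of variables; after S has been
  processed it holds the negated linear coefficients of the derivative with respect to S.\<close>

definition recorded :: "('n set \<Rightarrow> 'a::ab_group_add) \<Rightarrow> 'n set set \<Rightarrow> 'n set \<Rightarrow> 'n \<Rightarrow> 'a" where
  "recorded \<alpha> P = (\<lambda>S j. if S \<in> P \<and> j \<notin> S then - \<alpha> (insert j S) else 0)"

text \<open>The coefficient of \<open>T\<close> is stored redundantly, under \<open>T - {j}\<close>
  for every \<open>j\<close> in \<open>T\<close>; any choice serves, and the sign undoes the stored
  negation.\<close>

definition read_coeff :: "('n set \<Rightarrow> 'n \<Rightarrow> 'a::ab_group_add) \<Rightarrow> 'n set \<Rightarrow> 'a" where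
  "read_coeff W T = - W (T - {SOME j. j \<in> T}) (SOME j. j \<in> T)"

text \<open>For \<open>T\<close> of size above \<open>d\<close>, the default 0 of an unprocessed
  register agrees with the vanishing coefficient, so membership in \<open>P\<close> is demanded only
  up to size \<open>d\<close>.\<close>

lemma read_coeff_recorded:
  assumes "deg_le d \<alpha>" "T \<noteq> {}" "\<And>j. j \<in> T \<Longrightarrow> card T \<le> d \<Longrightarrow> T - {j} \<in> P"
  shows "read_coeff (recorded \<alpha> P) T = \<alpha> T"
proof -
  define j where "j = (SOME j. j \<in> T)"
  have j: "j \<in> T" unfolding j_def using assms(2) by (simp add: some_in_eq)
  have "read_coeff (recorded \<alpha> P) T = (if T - {j} \<in> P then \<alpha> T else 0)"
    using j by (simp add: read_coeff_def recorded_def j_def[symmetric] insert_absorb)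
  moreover have "\<alpha> T = 0" if "T - {j} \<notin> P"
    using assms(1) assms(3)[OF j] that unfolding deg_le_def by (metis not_less)
  ultimately show ?thesis by auto
qed

definition known_part :: "'n::finite set \<Rightarrow> ('n set \<Rightarrow> 'n \<Rightarrow> 'a::comm_ring_1) \<Rightarrow> ('n \<Rightarrow> 'a) \<Rightarrow> 'a" where
  "known_part S W x = (\<Sum>R\<in>{R. S \<subseteq> R \<and> card S + 2 \<le> card R}. read_coeff W R * (\<Prod>i\<in>R - S. x i))"

text \<open>The supersets \<open>R\<close> of \<open>S\<close> are split by the size of
  \<open>R - S\<close>: size 0 gives the constant, size 1 the linear terms, and larger sizes the
  known part.\<close>

lemma derivative_minus_known_part:
  fixes \<alpha> :: "'n::finite set \<Rightarrow> 'a::comm_ring_1"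
  assumes "deg_le d \<alpha>" and P: "\<And>R. card S < card R \<Longrightarrow> card R < d \<Longrightarrow> R \<in> P"
  shows "(\<Sum>R\<in>{R. S \<subseteq> R}. \<alpha> R * (\<Prod>i\<in>R - S. x i)) - known_part S (recorded \<alpha> P) x =
    \<alpha> S + (\<Sum>i\<in>UNIV. (if i \<in> S then 0 else \<alpha> (insert i S)) * x i)"
proof -
  let ?m = "\<lambda>R. \<alpha> R * (\<Prod>i\<in>R - S. x i)"
  let ?H = "{R. S \<subseteq> R \<and> card S + 2 \<le> card R}"
  have "{R. S \<subseteq> R} = insert S ((\<lambda>j. insert j S) ` (- S)) \<union> ?H"
  proof (intro equalityI subsetI)
    fix R assume "R \<in> {R. S \<subseteq> R}"
    then have SR: "S \<subseteq> R" by simp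
    then have R: "card R = card S + card (R - S)"
      by (metis card_Diff_subset card_mono finite le_add_diff_inverse)
    show "R \<in> insert S ((\<lambda>j. insert j S) ` (- S)) \<union> ?H"
    proof (cases "card (R - S) \<ge> 2")
      case True
      then show ?thesis using R SR by simp
    next
      case False
      then consider "card (R - S) = 0" | "card (R - S) = 1" by linarith
      then show ?thesis
      proof cases
        case 1
        then have "R = S" using SR by auto
        then show ?thesis by simp
      next
        case 2
        then obtain j where "R - S = {j}" by (auto simp: card_1_singleton_iff)
        then have "R = insert j S" "j \<notin> S" using SR by auto
        then show ?thesis by auto
      qed
    qed
  qed auto
  then have "(\<Sum>R\<in>{R. S \<subseteq> R}. ?m R) = (\<Sum>R\<in>insert S ((\<lambda>j. insert j S) ` (- S)) \<union> ?H. ?m R)"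
    by (simp only:)
  also have "\<dots> = (\<Sum>R\<in>insert S ((\<lambda>j. insert j S) ` (- S)). ?m R) + (\<Sum>R\<in>?H. ?m R)"
    by (rule sum.union_disjoint) (auto simp: card_insert_if)
  also have "(\<Sum>R\<in>insert S ((\<lambda>j. insert j S) ` (- S)). ?m R) =
      \<alpha> S + (\<Sum>R\<in>(\<lambda>j. insert j S) ` (- S). ?m R)"
    by (subst sum.insert) auto
  also have "(\<Sum>R\<in>(\<lambda>j. insert j S) ` (- S). ?m R) = (\<Sum>j\<in>- S. \<alpha> (insert j S) * x j)"
    by (subst sum.reindex) (auto simp: inj_on_def insert_Diff_if intro!: sum.cong)
  also have "\<dots> = (\<Sum>i\<in>UNIV. (if i \<in> S then 0 else \<alpha> (insert i S)) * x i)"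
    by (rule sum.mono_neutral_cong_left) auto
  also have "(\<Sum>R\<in>?H. ?m R) = known_part S (recorded \<alpha> P) x"
    unfolding known_part_def
  proof (intro sum.cong refl)
    fix R assume R: "R \<in> ?H"
    have "read_coeff (recorded \<alpha> P) R = \<alpha> R"
    proof (rule read_coeff_recorded[OF assms(1)])
      show "R \<noteq> {}" using R by auto
      \<comment> \<open>The size of \<open>R - {j}\<close> is above \<open>card S\<close> because
        \<open>R\<close> has at least two extra elements, and below \<open>d\<close> because
        \<open>card R \<le> d\<close>.\<close>
      show "R - {j} \<in> P" if "j \<in> R" "card R \<le> d" for j
        using R that by (intro P) auto
    qed
    then show "?m R = read_coeff (recorded \<alpha> P) R * (\<Prod>i\<in>R - S. x i)" by simp
  qed
  finally show ?thesis by simp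
qed

context additive_character
begin

lemma circuit_learn_step:
  fixes S :: "'n::finite set"
  assumes "S \<notin> P" and P: "\<And>R. card S < card R \<Longrightarrow> card R < d \<Longrightarrow> R \<in> P"
  shows "\<exists>F. circuit (2 ^ card S) F \<and> (\<forall>\<alpha> :: 'n set \<Rightarrow> 'a. \<forall>c. deg_le d \<alpha> \<longrightarrow>
    F (mlpoly \<alpha>) (\<lambda>b. c * ket ((\<lambda>_. 0, 1), recorded \<alpha> P) b) =
      (\<lambda>b. c * \<chi> (- \<alpha> S) * ket ((\<lambda>_. 0, 1), recorded \<alpha> (insert S P)) b))"
proof -
  let ?w = "TYPE('n set \<Rightarrow> 'n \<Rightarrow> 'a)"
  obtain G :: "(('n \<Rightarrow> 'a) \<Rightarrow> 'a) \<Rightarrow> ('n \<Rightarrow> 'a) \<Rightarrow> 'a" where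
    G: "adds (2 ^ card S) G ?w"
    "\<And>\<alpha> x. G (mlpoly \<alpha>) x = (\<Sum>R\<in>{R. S \<subseteq> R}. \<alpha> R * (\<Prod>i\<in>R - S. x i))"
    using adds_derivative[of S, where 'w = "'n set \<Rightarrow> 'n \<Rightarrow> 'a"] by blast
  \<comment> \<open>Under \<open>pull\<close>, the plus sign subtracts the known part.\<close>
  let ?K = "\<lambda>((x, y), w). ((x, y + known_part S w x), w) :: ('n, 'a, 'n set \<Rightarrow> 'n \<Rightarrow> 'a) tbasis"
  let ?K' = "\<lambda>((x, y), w). ((x, y - known_part S w x), w) :: ('n, 'a, 'n set \<Rightarrow> 'n \<Rightarrow> 'a) tbasis"
  let ?X = "\<lambda>((x, y), w). ((w S, y), w(S := x)) :: ('n, 'a, 'n set \<Rightarrow> 'n \<Rightarrow> 'a) tbasis"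
  let ?G = "\<lambda>f. pull (\<lambda>((x, y), w). ((x, y - G f x), w) :: ('n, 'a, 'n set \<Rightarrow> 'n \<Rightarrow> 'a) tbasis)"
  define F where "F = (\<lambda>f. pull ?X \<circ> (fourier (- 1) \<circ> (pull ?K \<circ> (?G f \<circ> fourier 1))))"
  have K: "unitary_op (pull ?K)"
    by (rule unitary_op_pull, rule o_bij[where g = ?K']) auto
  have X: "unitary_op (pull ?X)"
    by (rule unitary_op_pull_involution) auto
  have "circuit (2 ^ card S) F"
    unfolding F_def
    by (intro circuit_then_unitary unitary_then_circuit G(1)[unfolded adds_def] K X unitary_op_fourier)
      simp_all
  moreover have "F (mlpoly \<alpha>) (\<lambda>b. c * ket ((\<lambda>_. 0, 1), recorded \<alpha> P) b) =
      (\<lambda>b. c * \<chi> (- \<alpha> S) * ket ((\<lambda>_. 0, 1), recorded \<alpha> (insert S P)) b)"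
    if "deg_le d \<alpha>" for \<alpha> :: "'n set \<Rightarrow> 'a" and c
  proof -
    define l where "l = (\<lambda>i. if i \<in> S then 0 else \<alpha> (insert i S))"
    let ?L = "\<lambda>w x. G (mlpoly \<alpha>) x - known_part S w x"
    have L: "?L (recorded \<alpha> P) x = \<alpha> S + (\<Sum>i\<in>UNIV. l i * x i)" for x
      unfolding G(2) l_def by (rule derivative_minus_known_part[OF that P])
    have "pull ?K (?G (mlpoly \<alpha>) \<psi>) = pull (\<lambda>((x, y), w). ((x, y - ?L w x), w)) \<psi>" for \<psi>
      by (auto simp: pull_def fun_eq_iff algebra_simps)
    then have "F (mlpoly \<alpha>) (\<lambda>b. c * ket ((\<lambda>_. 0, 1), recorded \<alpha> P) b) =
        pull ?X (\<lambda>b. c * \<chi> (- \<alpha> S) * ket ((\<lambda>i. - l i, 1), recorded \<alpha> P) b)"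
      using bernstein_vazirani[where L = ?L, OF L] by (simp only: F_def comp_apply)
    also have "\<dots> = (\<lambda>b. c * \<chi> (- \<alpha> S) * ket ((\<lambda>_. 0, 1), recorded \<alpha> (insert S P)) b)"
    proof -
      have "\<rho> b = b'' \<longleftrightarrow> b = b'" if "\<And>b. \<rho> (\<rho> b) = b" "\<rho> b' = b''"
        for \<rho> :: "('n, 'a, 'n set \<Rightarrow> 'n \<Rightarrow> 'a) tbasis \<Rightarrow> _" and b b' b''
        using that by metis
      \<comment> \<open>Since \<open>S\<close> is not in \<open>P\<close>, its register still holds
        the default 0, which the swap returns to the input register.\<close>
      moreover have "?X ((\<lambda>_. 0, 1), recorded \<alpha> (insert S P)) = ((\<lambda>i. - l i, 1), recorded \<alpha> P)"
        using assms(1) by (auto simp: recorded_def l_def fun_eq_iff)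
      moreover have "?X (?X b) = b" for b by (simp add: case_prod_beta prod_eq_iff)
      ultimately have swap_eq: "?X b = ((\<lambda>i. - l i, 1), recorded \<alpha> P) \<longleftrightarrow>
          b = ((\<lambda>_. 0, 1), recorded \<alpha> (insert S P))" for b
        by blast
      show ?thesis unfolding pull_def ket_def swap_eq ..
    qed
    finally show ?thesis .
  qed
  ultimately show ?thesis by blast
qed

text \<open>The hypothesis says that \<open>P\<close> contains every set of size below
  \<open>d\<close> that is larger than some member, so all data for a member's known part can be
  available. The phases multiply to a global phase.\<close>

lemma circuit_learn_sets:
  fixes P :: "'n::finite set set"
  assumes "\<And>S R. S \<in> P \<Longrightarrow> card S < card R \<Longrightarrow> card R < d \<Longrightarrow> R \<in> P"
  shows "\<exists>F. circuit (\<Sum>S\<in>P. 2 ^ card S) F \<and> (\<forall>\<alpha> :: 'n set \<Rightarrow> 'a. deg_le d \<alpha> \<longrightarrow> (\<exists>c. cmod c = 1 \<and>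
    F (mlpoly \<alpha>) (ket ((\<lambda>_. 0, 1), \<lambda>_ _. 0)) = (\<lambda>b. c * ket ((\<lambda>_. 0, 1), recorded \<alpha> P) b)))"
  using finite[of P] assms
\<comment> \<open>With negated size as rank, the inserted set is a smallest one and is processed
  last.\<close>
proof (induction rule: finite_ranking_induct[where f = "\<lambda>S. - int (card S)"])
  case empty
  have "recorded \<alpha> {} = (\<lambda>_ _. 0)" for \<alpha> :: "'n set \<Rightarrow> 'a"
    by (simp add: recorded_def)
  then show ?case
    by (intro exI[of _ "\<lambda>f \<psi>. \<psi>"] conjI allI impI exI[of _ 1])
      (use circuit_unitary[OF unitary_op_id] in auto)
next
  case (insert S P)
  show ?case
  proof (cases "S \<in> P")
    case True
    then show ?thesis using insert.IH insert.prems by (simp add: insert_absorb)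
  next
    case False
    \<comment> \<open>The closure condition survives removal of \<open>S\<close>: \<open>R\<close>
      is larger than a member of \<open>P\<close>, hence larger than \<open>S\<close>, and so
      differs from it.\<close>
    have "R \<in> P" if "T \<in> P" "card T < card R" "card R < d" for T R
      using insert.prems[of T R] insert.hyps(2)[OF that(1)] that by auto
    then obtain F where F: "circuit (\<Sum>S\<in>P. 2 ^ card S) F"
      "\<And>\<alpha> :: 'n set \<Rightarrow> 'a. deg_le d \<alpha> \<Longrightarrow> \<exists>c. cmod c = 1 \<and>
        F (mlpoly \<alpha>) (ket ((\<lambda>_. 0, 1), \<lambda>_ _. 0)) = (\<lambda>b. c * ket ((\<lambda>_. 0, 1), recorded \<alpha> P) b)"
      using insert.IH by blast
    have "R \<in> P" if "card S < card R" "card R < d" for R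
      using insert.prems[of S R] that by auto
    then obtain G where G: "circuit (2 ^ card S) G"
      "\<And>(\<alpha> :: 'n set \<Rightarrow> 'a) c. deg_le d \<alpha> \<Longrightarrow>
        G (mlpoly \<alpha>) (\<lambda>b. c * ket ((\<lambda>_. 0, 1), recorded \<alpha> P) b) =
        (\<lambda>b. c * \<chi> (- \<alpha> S) * ket ((\<lambda>_. 0, 1), recorded \<alpha> (insert S P)) b)"
      using circuit_learn_step[OF False] by metis
    have "circuit (\<Sum>S\<in>insert S P. 2 ^ card S) (\<lambda>f. G f \<circ> F f)"
      using circuit_comp[OF G(1) F(1)] insert.hyps(1) False by (simp add: add.commute)
    moreover have "\<exists>c. cmod c = 1 \<and> (G (mlpoly \<alpha>) \<circ> F (mlpoly \<alpha>)) (ket ((\<lambda>_. 0, 1), \<lambda>_ _. 0)) =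
        (\<lambda>b. c * ket ((\<lambda>_. 0, 1), recorded \<alpha> (insert S P)) b)" if deg: "deg_le d \<alpha>" for \<alpha> :: "'n set \<Rightarrow> 'a"
    proof -
      obtain c where "cmod c = 1"
        "F (mlpoly \<alpha>) (ket ((\<lambda>_. 0, 1), \<lambda>_ _. 0)) = (\<lambda>b. c * ket ((\<lambda>_. 0, 1), recorded \<alpha> P) b)"
        using F(2)[OF deg] by blast
      then show ?thesis
        using G(2)[OF deg, of c] by (intro exI[of _ "c * \<chi> (- \<alpha> S)"]) (simp add: norm_mult)
    qed
    ultimately show ?thesis by blast
  qed
qed

end

section \<open>The constant coefficient and the decoding of the final basis state\<close>

lemma mlpoly_zero: "mlpoly \<alpha> (\<lambda>_. 0) = \<alpha> {}"
proof -
  have "mlpoly \<alpha> (\<lambda>_. 0) = (\<Sum>S\<in>{{}}. \<alpha> S * (\<Prod>i\<in>S. 0))"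
    unfolding mlpoly_def by (rule sum.mono_neutral_right) (auto simp: power_0_left)
  then show ?thesis by simp
qed

lemma circuit_learn:
  fixes d :: nat
  shows "\<exists>F decode. circuit (1 + (\<Sum>S\<in>{S :: 'n::finite set. card S < d}. 2 ^ card S)) F \<and>
    (\<forall>\<alpha> :: 'n set \<Rightarrow> 'a::{finite,field}. deg_le d \<alpha> \<longrightarrow> (\<exists>c b. cmod c = 1 \<and> decode b = \<alpha> \<and>
      F (mlpoly \<alpha>) (ket ((\<lambda>_. 0, 1), (\<lambda>_ _. 0) :: 'n set \<Rightarrow> 'n \<Rightarrow> 'a)) = (\<lambda>b'. c * ket b b')))"
proof -
  obtain \<chi> :: "'a \<Rightarrow> complex" where "additive_character \<chi>"
    using ex_additive_character by blast
  then interpret additive_character \<chi> .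
  let ?P = "{S :: 'n set. card S < d}"
  obtain F where F: "circuit (\<Sum>S\<in>?P. 2 ^ card S) F"
    "\<And>\<alpha> :: 'n set \<Rightarrow> 'a. deg_le d \<alpha> \<Longrightarrow> \<exists>c. cmod c = 1 \<and>
      F (mlpoly \<alpha>) (ket ((\<lambda>_. 0, 1), \<lambda>_ _. 0)) = (\<lambda>b. c * ket ((\<lambda>_. 0, 1), recorded \<alpha> ?P) b)"
    using circuit_learn_sets[of ?P d] by auto
  let ?Q = "\<lambda>f. pull (\<lambda>((x, y), w). ((x, y - f x), w) :: ('n, 'a, 'n set \<Rightarrow> 'n \<Rightarrow> 'a) tbasis)"
  \<comment> \<open>The last query is made with the input register at 0 and adds the constant
    coefficient to an answer register holding 1, hence the subtraction of 1.\<close>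
  define decode :: "('n, 'a, 'n set \<Rightarrow> 'n \<Rightarrow> 'a) tbasis \<Rightarrow> 'n set \<Rightarrow> 'a"
    where "decode = (\<lambda>((x, y), w) T. if T = {} then y - 1 else read_coeff w T)"
  have "circuit (1 + (\<Sum>S\<in>?P. 2 ^ card S)) (\<lambda>f. ?Q f \<circ> F f)"
    using circuit_comp[OF adds_oracle[unfolded adds_def] F(1)] by simp
  moreover have "\<exists>c b. cmod c = 1 \<and> decode b = \<alpha> \<and>
      (?Q (mlpoly \<alpha>) \<circ> F (mlpoly \<alpha>)) (ket ((\<lambda>_. 0, 1), \<lambda>_ _. 0)) = (\<lambda>b'. c * ket b b')"
    if deg: "deg_le d \<alpha>" for \<alpha> :: "'n set \<Rightarrow> 'a"
  proof -
    obtain c where c: "cmod c = 1"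
      "F (mlpoly \<alpha>) (ket ((\<lambda>_. 0, 1), \<lambda>_ _. 0)) = (\<lambda>b. c * ket ((\<lambda>_. 0, 1), recorded \<alpha> ?P) b)"
      using F(2)[OF deg] by blast
    have "read_coeff (recorded \<alpha> ?P) T = \<alpha> T" if "T \<noteq> {}" for T
    proof (rule read_coeff_recorded[OF deg that])
      fix j assume "j \<in> T" "card T \<le> d"
      then show "T - {j} \<in> ?P" using card_Diff1_less[of T j] by simp
    qed
    then have "decode ((\<lambda>_. 0, 1 + \<alpha> {}), recorded \<alpha> ?P) = \<alpha>"
      by (auto simp: decode_def)
    moreover have "(?Q (mlpoly \<alpha>) \<circ> F (mlpoly \<alpha>)) (ket ((\<lambda>_. 0, 1), \<lambda>_ _. 0)) =
        (\<lambda>b. c * ket ((\<lambda>_. 0, 1 + \<alpha> {}), recorded \<alpha> ?P) b)"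
    proof -
      have "((x, y - mlpoly \<alpha> x), w) = ((\<lambda>_. 0, 1), recorded \<alpha> ?P) \<longleftrightarrow>
          ((x, y), w) = ((\<lambda>_. 0, 1 + \<alpha> {}), recorded \<alpha> ?P)" for x y w
        using mlpoly_zero[of \<alpha>] by (auto simp: algebra_simps)
      then show ?thesis
        unfolding comp_apply c(2) unfolding pull_def ket_def by (simp add: case_prod_beta prod_eq_iff)
    qed
    ultimately show ?thesis using c(1) by blast
  qed
  ultimately show ?thesis by blast
qed

section \<open>Transfer to the query model\<close>

locale workspace_encoding =
  fixes m :: nat and dec :: "nat \<Rightarrow> 'w::finite"
  assumes bij_dec: "bij_betw dec {..<m} UNIV"
begin

definition decb :: "('n, 'a) qbasis \<Rightarrow> ('n, 'a, 'w) tbasis" where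
  "decb = (\<lambda>(x, y, w). ((x, y), dec w))"

lemma bij_decb: "bij_betw (decb :: ('n, 'a) qbasis \<Rightarrow> _) (basis_set m) UNIV"
  unfolding bij_betw_def
proof
  show "inj_on (decb :: ('n, 'a) qbasis \<Rightarrow> _) (basis_set m)"
    using bij_dec by (auto simp: inj_on_def decb_def basis_set_def bij_betw_def)
  have "((x, y), w) \<in> decb ` basis_set m" for x :: "'n \<Rightarrow> 'a" and y w
  proof -
    obtain i where "i < m" "dec i = w" using bij_dec unfolding bij_betw_def by (metis UNIV_I imageE lessThan_iff)
    then show ?thesis by (intro image_eqI[of _ _ "(x, y, i)"]) (auto simp: decb_def basis_set_def)
  qed
  then show "decb ` basis_set m = (UNIV :: ('n, 'a, 'w) tbasis set)" by auto
qed

text \<open>Amplitudes outside \<open>basis_set m\<close> are set to 0, as in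
  \<open>mat_app\<close>.\<close>

definition embed :: "(('n, 'a, 'w) tbasis \<Rightarrow> complex) \<Rightarrow> ('n, 'a) qstate" where
  "embed \<psi> = (\<lambda>b. if b \<in> basis_set m then \<psi> (decb b) else 0)"

lemma sum_basis_set: "(\<Sum>b\<in>basis_set m. g (decb b)) = (\<Sum>b\<in>UNIV. g b)"
  by (rule sum.reindex_bij_betw[OF bij_decb])

lemma unitary_op_realizable:
  fixes T :: "(('n::finite, 'a::finite, 'w) tbasis \<Rightarrow> complex) \<Rightarrow> ('n, 'a, 'w) tbasis \<Rightarrow> complex"
  assumes "unitary_op T"
  obtains U :: "('n, 'a) qmat" where "qunitary m U" "\<And>\<psi>. mat_app m U (embed \<psi>) = embed (T \<psi>)"
proof -
  obtain V where V: "orthonormal V" "T = mat_vec V" using assms unfolding unitary_op_def by blast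
  define U :: "('n, 'a) qmat" where "U = (\<lambda>b b'. V (decb b) (decb b'))"
  have "qunitary m U"
    unfolding qunitary_def
  proof (intro ballI)
    fix b b' :: "('n, 'a) qbasis" assume bb: "b \<in> basis_set m" "b' \<in> basis_set m"
    have "(\<Sum>c\<in>basis_set m. cnj (U c b) * U c b') = (if decb b = decb b' then 1 else 0)"
      using V(1) unfolding U_def orthonormal_def
      by (subst sum_basis_set[where g = "\<lambda>c. cnj (V c (decb b)) * V c (decb b')"]) blast
    moreover have "decb b = decb b' \<longleftrightarrow> b = b'"
      using bij_decb bb by (auto simp: bij_betw_def inj_on_def)
    ultimately show "(\<Sum>c\<in>basis_set m. cnj (U c b) * U c b') = (if b = b' then 1 else 0)" by simp
  qed
  moreover have "mat_app m U (embed \<psi>) = embed (T \<psi>)" for \<psi>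
  proof
    fix b :: "('n, 'a) qbasis"
    have "(\<Sum>b'\<in>basis_set m. U b b' * embed \<psi> b') =
        (\<Sum>b'\<in>basis_set m. (\<lambda>t. V (decb b) t * \<psi> t) (decb b'))"
      by (intro sum.cong) (auto simp: embed_def U_def)
    then show "mat_app m U (embed \<psi>) b = embed (T \<psi>) b"
      using sum_basis_set[of "\<lambda>t. V (decb b) t * \<psi> t"]
      by (simp add: mat_app_def embed_def V(2) mat_vec_def)
  qed
  ultimately show ?thesis using that by blast
qed

lemma query_op_embed:
  "query_op f (embed \<psi>) = embed (pull (\<lambda>((x, y), w). ((x, y - f x), w)) \<psi>)"
  by (auto simp: fun_eq_iff query_op_def embed_def pull_def decb_def basis_set_def)

lemma circuit_realizable:
  fixes F :: "(('n::finite \<Rightarrow> 'a::{finite,ab_group_add}) \<Rightarrow> 'a)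
    \<Rightarrow> (('n, 'a, 'w) tbasis \<Rightarrow> complex) \<Rightarrow> ('n, 'a, 'w) tbasis \<Rightarrow> complex"
  assumes "circuit k F"
  shows "\<exists>(U0 :: ('n, 'a) qmat) Us. qunitary m U0 \<and> (\<forall>U\<in>set Us. qunitary m U) \<and> length Us = k \<and>
    (\<forall>f \<psi>. foldl (\<lambda>\<psi> U. mat_app m U (query_op f \<psi>)) (mat_app m U0 (embed \<psi>)) Us = embed (F f \<psi>))"
  using assms
proof induction
  case (circuit_unitary T)
  obtain U where "qunitary m U" "\<And>\<psi>. mat_app m U (embed \<psi>) = embed (T \<psi>)"
    using unitary_op_realizable[OF circuit_unitary] by blast
  then show ?case by (intro exI[of _ U] exI[of _ "[]"]) auto
next
  case (circuit_query k F T)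
  then obtain U0 Us where "qunitary m U0" "\<forall>U\<in>set Us. qunitary m U" "length Us = k"
    "\<And>f \<psi>. foldl (\<lambda>\<psi> U. mat_app m U (query_op f \<psi>)) (mat_app m U0 (embed \<psi>)) Us = embed (F f \<psi>)"
    by blast
  moreover obtain U where "qunitary m U" "\<And>\<psi>. mat_app m U (embed \<psi>) = embed (T \<psi>)"
    using unitary_op_realizable[OF circuit_query(2)] by blast
  ultimately show ?case
    by (intro exI[of _ U0] exI[of _ "Us @ [U]"]) (auto simp: query_op_embed)
qed

lemma init_state_embed:
  assumes "0 < m"
  shows "(init_state :: ('n, 'a::zero) qstate) = embed (ket (decb (\<lambda>_. 0, 0, 0)))"
proof
  fix b :: "('n, 'a) qbasis"
  have "((\<lambda>_. 0, 0, 0) :: ('n, 'a) qbasis) \<in> basis_set m" using assms by (simp add: basis_set_def)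
  then show "init_state b = embed (ket (decb (\<lambda>_. 0, 0, 0))) b"
    using bij_decb by (auto simp: init_state_def embed_def ket_def bij_betw_def inj_on_def)
qed

text \<open>The global phase disappears in the modulus, so measuring yields the basis state with
  certainty.\<close>

lemma out_prob_embed_ket:
  fixes b :: "('n::finite, 'a::finite, 'w) tbasis"
  assumes "cmod c = 1"
  shows "out_prob m (embed (\<lambda>b'. c * ket b b')) (\<lambda>b. decode (decb b)) (decode b) = 1"
proof -
  have "out_prob m (embed (\<lambda>b'. c * ket b b')) (\<lambda>b. decode (decb b)) (decode b) =
      (\<Sum>b'\<in>basis_set m. (\<lambda>t. if t = b then 1 else 0) (decb b'))"
    unfolding out_prob_def using assms
    by (intro sum.cong) (auto simp: embed_def ket_def norm_mult)
  also have "\<dots> = 1" using sum_basis_set[of "\<lambda>t. if t = b then 1 else 0"] by simp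
  finally show ?thesis .
qed

end

section \<open>Counting the queries by set size, and assembling the algorithm\<close>

lemma sum_pow2_card_lt:
  "(\<Sum>S\<in>{S :: 'n::finite set. card S < d}. (2::nat) ^ card S) =
    (\<Sum>i=1..d. 2 ^ (i - 1) * (card (UNIV :: 'n set) choose (i - 1)))"
proof (induction d)
  case (Suc d)
  have "{S :: 'n set. card S < Suc d} = {S. card S < d} \<union> {S. card S = d}" by auto
  then have "(\<Sum>S\<in>{S :: 'n set. card S < Suc d}. (2::nat) ^ card S) =
      (\<Sum>S\<in>{S :: 'n set. card S < d} \<union> {S. card S = d}. 2 ^ card S)"
    by (simp only:)
  also have "\<dots> = (\<Sum>S\<in>{S :: 'n set. card S < d}. 2 ^ card S) + (\<Sum>S\<in>{S :: 'n set. card S = d}. 2 ^ card S)"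
    by (rule sum.union_disjoint) auto
  also have "(\<Sum>S\<in>{S :: 'n set. card S = d}. (2::nat) ^ card S) = 2 ^ d * (card (UNIV :: 'n set) choose d)"
    using n_subsets[of "UNIV :: 'n set" d] by (simp add: mult.commute)
  finally show ?case using Suc.IH by simp
qed simp

theorem theorem2:
  fixes d :: nat
  shows "\<exists>(m::nat) (U0 :: ('n::finite, 'a::{finite,field}) qmat) Us
           (out :: ('n, 'a) qbasis \<Rightarrow> ('n set \<Rightarrow> 'a)).
     0 < m \<and> qunitary m U0 \<and> (\<forall>U\<in>set Us. qunitary m U) \<and>
     length Us = 1 + (\<Sum>i=1..d. 2 ^ (i - 1) * (card (UNIV :: 'n set) choose (i - 1))) \<and>
     (\<forall>\<alpha> :: 'n set \<Rightarrow> 'a. deg_le d \<alpha> \<longrightarrow>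
        out_prob m (final_state m (mlpoly \<alpha>) U0 Us) out \<alpha> = 1)"
proof -
  define m where "m = CARD('n set \<Rightarrow> 'n \<Rightarrow> 'a)"
  have "\<exists>dec. bij_betw dec {..<m} (UNIV :: ('n set \<Rightarrow> 'n \<Rightarrow> 'a) set)"
    unfolding m_def using ex_bij_betw_nat_finite[of "UNIV :: ('n set \<Rightarrow> 'n \<Rightarrow> 'a) set"]
    by (simp add: atLeast0LessThan)
  then obtain dec :: "nat \<Rightarrow> 'n set \<Rightarrow> 'n \<Rightarrow> 'a" where "bij_betw dec {..<m} UNIV" by blast
  then interpret workspace_encoding m dec by unfold_locales
  have m: "0 < m" unfolding m_def by (rule zero_less_card_finite)
  let ?b0 = "decb (\<lambda>_. 0, 0, 0) :: ('n, 'a, 'n set \<Rightarrow> 'n \<Rightarrow> 'a) tbasis"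
  let ?b1 = "((\<lambda>_. 0, 1), (\<lambda>_ _. 0)) :: ('n, 'a, 'n set \<Rightarrow> 'n \<Rightarrow> 'a) tbasis"
  obtain F decode where F: "circuit (1 + (\<Sum>S\<in>{S :: 'n set. card S < d}. 2 ^ card S)) F"
    "\<And>\<alpha> :: 'n set \<Rightarrow> 'a. deg_le d \<alpha> \<Longrightarrow>
      \<exists>c b. cmod c = 1 \<and> decode b = \<alpha> \<and> F (mlpoly \<alpha>) (ket ?b1) = (\<lambda>b'. c * ket b b')"
    using circuit_learn[of d, where 'n = 'n and 'a = 'a] by blast
  let ?T = "pull (transpose ?b0 ?b1)"
  have "unitary_op ?T" by (rule unitary_op_pull) simp
  from circuit_realizable[OF unitary_then_circuit[OF F(1) this]]
  obtain U0 :: "('n, 'a) qmat" and Us where U: "qunitary m U0" "\<forall>U\<in>set Us. qunitary m U"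
    "length Us = 1 + (\<Sum>S\<in>{S :: 'n set. card S < d}. 2 ^ card S)"
    "\<And>f \<psi>. foldl (\<lambda>\<psi> U. mat_app m U (query_op f \<psi>)) (mat_app m U0 (embed \<psi>)) Us =
      embed ((F f \<circ> ?T) \<psi>)"
    by blast
  have T: "?T (ket ?b0) = ket ?b1"
    by (rule pull_transpose_ket)
  have "out_prob m (final_state m (mlpoly \<alpha>) U0 Us) (\<lambda>b. decode (decb b)) \<alpha> = 1"
    if deg: "deg_le d \<alpha>" for \<alpha> :: "'n set \<Rightarrow> 'a"
  proof -
    obtain c b where "cmod c = 1" "decode b = \<alpha>" "F (mlpoly \<alpha>) (ket ?b1) = (\<lambda>b'. c * ket b b')"
      using F(2)[OF deg] by blast
    moreover have "final_state m (mlpoly \<alpha>) U0 Us = embed (F (mlpoly \<alpha>) (ket ?b1))"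
      unfolding final_state_def init_state_embed[OF m] U(4) comp_apply T ..
    ultimately show ?thesis using out_prob_embed_ket[of c b decode] by simp
  qed
  with m U show ?thesis unfolding sum_pow2_card_lt by blast
qed

end
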